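(* Let $F:\mathbb{R}^2\times\mathbb{R}\to\mathbb{R}$, $(x,y,\alpha)\mapsto F(x,y,\alpha)$, be of class $\mathcal{C}^2$, and let $f:U\to\mathbb{R}$ be of class $\mathcal{C}^2$ on an open set $U\subset\mathbb{R}^2$ with $F(x,f(x,\alpha),\alpha)=0$ for all $(x,\alpha)\in U$. Let $x_0$ be a periodic point of period $p\ge 1$ of $f(\cdot,\alpha)$, with orbit $x_j=f^j(x_0,\alpha)$, $(x_j,\alpha)\in U$ for $0\le j\le p-1$, $x_p=x_0$, $F_y(x_j,x_{j+1},\alpha)\neq0$ for $0\le j\le p-1$, and $\partial_x f^{p}(x_0,\alpha)=\varepsilon$ with $\varepsilon\in\{1,-1\}$. Then $$\partial_{\alpha x}f^{p}(x_0,\alpha)=\varepsilon\sum_{j=0}^{p-1}\left(\frac{\widetilde F_{x^2}^{j}-2\widetilde F_{xy}^{j}\widetilde\nu_j+\widetilde F_{y^2}^{j}\widetilde\nu_j^2}{\widetilde F_x^{j}}\,\partial_\alpha f^{j}+\left(\frac{\widetilde F_{y^2}^{j}}{\widetilde F_y^{j}}-\frac{\widetilde F_{xy}^{j}}{\widetilde F_x^{j}}\right)\frac{\widetilde F_\alpha^{j}}{\widetilde F_y^{j}}+\frac{\widetilde F_{x\alpha}^{j}}{\widetilde F_x^{j}}-\frac{\widetilde F_{y\alpha}^{j}}{\widetilde F_y^{j}}\right),$$ where $$\partial_\alpha f^{j}=\partial_\alpha f^{j}(x_0,\alpha)=(-1)^{j}\sum_{k=0}^{j-1}\frac{(-1)^k\widetilde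 F_\alpha^{k}}{\widetilde F_y^{k}}\prod_{i=k+1}^{j-1}\widetilde\nu_i$$ (empty sums are $0$ and empty products are $1$).
   Context: The equation $F(x_n,x_{n+1},\alpha)=0$ defines implicitly a one-dimensional discrete dynamical system $x_{n+1}=f(x_n,\alpha)$, where $\alpha$ is a real parameter. $f^{i}$ denotes the $i$-fold composition of $f$ in the dynamic variable with the parameter fixed: $f^{0}(x,\alpha)=x$, $f^{i+1}(x,\alpha)=f(f^{i}(x,\alpha),\alpha)$. Subscripts on $F$ denote partial derivatives with respect to its first argument $x$, second argument $y$ and third argument $\alpha$ ($F_{x^2}=F_{xx}$, $F_{y^2}=F_{yy}$). $\widetilde F_x^{j}$, $\widetilde F_y^{j}$, $\widetilde F_\alpha^{j}$, $\widetilde F_{x^2}^{j}$, $\widetilde F_{xy}^{j}$, $\widetilde F_{y^2}^{j}$, $\widetilde F_{x\alpha}^{j}$, $\widetilde F_{y\alpha}^{j}$ denote these derivatives evaluated at $(x_j,x_{j+1},\alpha)$ (the superscript $j$ is an index; $\widetilde\nu_j^2$ is an ordinary power), and $\widetilde\nu_j=\widetilde F_x^{j}/\widetilde F_y^{j}$. The $\widetilde F_x^j$ are automatically nonzero, since $\partial_xf^p(x_0,\alpha)=\pm1$. $\partial_\alpha f^{j}$ and $\partial_{\alpha x}f^{p}$ are partial derivatives (first order in $\alpha$, and mixed second order in $\alpha$ and $x$) of the functions $(x,\alpha)\mapsto f^{j}(x,\alpha)$ and $(x,\alpha)\mapsto f^{p}(x,\alpha)$. *)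

theory Defs
  imports "HOL-Analysis.Analysis"
begin

text \<open>Class \<open>C\<^sup>2\<close> on a set, meant for open sets: the derivatives are total (Frechet)
  derivatives taken at points with respect to the full space.\<close>

definition C2_on :: "('a::real_normed_vector) set \<Rightarrow> ('a \<Rightarrow> 'b::real_normed_vector) \<Rightarrow> bool" where
  "C2_on S g \<longleftrightarrow>
    (\<exists>(g' :: 'a \<Rightarrow> 'a \<Rightarrow>\<^sub>L 'b) (g'' :: 'a \<Rightarrow> 'a \<Rightarrow>\<^sub>L ('a \<Rightarrow>\<^sub>L 'b)).
        (\<forall>z\<in>S. (g has_derivative blinfun_apply (g' z)) (at z)) \<and>
        (\<forall>z\<in>S. (g' has_derivative blinfun_apply (g'' z)) (at z)) \<and>
        continuous_on S g'')"

definition F_dx :: "(real \<times> real \<times> real \<Rightarrow> real) \<Rightarrow> real \<times> real \<times> real \<Rightarrow> real" where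
  "F_dx F = (\<lambda>(x, y, a). deriv (\<lambda>t. F (t, y, a)) x)"

definition F_dy :: "(real \<times> real \<times> real \<Rightarrow> real) \<Rightarrow> real \<times> real \<times> real \<Rightarrow> real" where
  "F_dy F = (\<lambda>(x, y, a). deriv (\<lambda>t. F (x, t, a)) y)"

definition F_da :: "(real \<times> real \<times> real \<Rightarrow> real) \<Rightarrow> real \<times> real \<times> real \<Rightarrow> real" where
  "F_da F = (\<lambda>(x, y, a). deriv (\<lambda>t. F (x, y, t)) a)"

definition map_dx :: "(real \<times> real \<Rightarrow> real) \<Rightarrow> real \<times> real \<Rightarrow> real" where
  "map_dx g = (\<lambda>(x, a). deriv (\<lambda>t. g (t, a)) x)"

definition map_da :: "(real \<times> real \<Rightarrow> real) \<Rightarrow> real \<times> real \<Rightarrow> real" where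
  "map_da g = (\<lambda>(x, a). deriv (\<lambda>t. g (x, t)) a)"

text \<open>A map \<open>f : U \<rightarrow> \<real>\<close> is represented by a total function whose values outside \<open>U\<close> are
  arbitrary. If \<open>U\<close> is open, \<open>f\<close> is continuous on \<open>U\<close> and the first \<open>i\<close> points of the orbit
  of \<open>x\<close> under \<open>f(\<cdot>, a)\<close> lie in \<open>U\<close>, then the values on \<open>U\<close> alone determine \<open>iter f i\<close> in a
  neighbourhood of \<open>(x, a)\<close>, hence also its partial derivatives there.\<close>

definition iter :: "(real \<times> real \<Rightarrow> real) \<Rightarrow> nat \<Rightarrow> real \<times> real \<Rightarrow> real" where
  "iter f i = (\<lambda>(x, a). ((\<lambda>t. f (t, a)) ^^ i) x)"

end

theory Submission
  imports Defs
begin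

text \<open>By the chain rule along the orbit, \<open>\<partial>\<^sub>x f\<^sup>p(x\<^sub>0, a)\<close> is the product of the slopes
  \<open>f\<^sub>x(x\<^sub>j(a), a)\<close>, \<open>j < p\<close>, where \<open>x\<^sub>j(a) = f\<^sup>j(x\<^sub>0, a)\<close>, and this holds for all \<open>a\<close> close to
  \<open>\<alpha>\<close> because the orbit then still stays in the open set \<open>U\<close> (\<open>iter_dx\<close>,
  \<open>eventually_orbit_in_open\<close>). At \<open>a = \<alpha>\<close> the product is \<open>\<epsilon> \<noteq> 0\<close>, so all factors are nonzero
  and the product can be differentiated logarithmically (\<open>iter_mixed_derivative\<close>): the mixed
  derivative is \<open>\<epsilon>\<close> times the sum of \<open>(f\<^sub>x\<^sub>x \<cdot> \<partial>\<^sub>\<alpha>f\<^sup>j + f\<^sub>x\<^sub>\<alpha>) / f\<^sub>x\<close> at the orbit points.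

  The partial derivatives of \<open>f\<close> are expressed by those of \<open>F\<close> by differentiating
  \<open>F(x, f(x, a), a) = 0\<close> once (\<open>implicit_partials\<close>), which gives \<open>f\<^sub>x = -\<nu>\<close> and
  \<open>f\<^sub>\<alpha> = -F\<^sub>\<alpha> / F\<^sub>y\<close>, and then once more (\<open>implicit_second_partials\<close>). Substituting them turns each
  logarithmic derivative into the summand of the theorem (\<open>implicit_log_derivative\<close>). The cross
  term \<open>2 F\<^sub>x\<^sub>y\<close> relies on the symmetry of second derivatives, proved in
  \<open>second_derivative_symmetric\<close>. The formula for \<open>\<partial>\<^sub>\<alpha>f\<^sup>j\<close> solves the linear recurrence
  \<open>\<partial>\<^sub>\<alpha>f\<^sup>j\<^sup>+\<^sup>1 = f\<^sub>x \<cdot> \<partial>\<^sub>\<alpha>f\<^sup>j + f\<^sub>\<alpha>\<close> (\<open>iter_da\<close>, \<open>alternating_recurrence_closed_form\<close>).\<close>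

section \<open>Symmetry of second derivatives\<close>

lemma has_derivative_along_line:
  fixes g :: "'a::real_normed_vector \<Rightarrow> real"
  assumes "(g has_derivative D) (at (w + s *\<^sub>R u))"
  shows "((\<lambda>s. g (w + s *\<^sub>R u)) has_real_derivative D u) (at s)"
proof -
  have "((\<lambda>s. g (w + s *\<^sub>R u)) has_derivative (\<lambda>k. D (k *\<^sub>R u))) (at s)"
    by (rule has_derivative_compose[where f="\<lambda>s. w + s *\<^sub>R u", OF _ assms])
      (auto intro!: derivative_eq_intros)
  moreover have "(\<lambda>k. D (k *\<^sub>R u)) = (*) (D u)"
    using has_derivative_bounded_linear[OF assms]
    by (auto simp: fun_eq_iff bounded_linear.linear linear_cmul)
  ultimately show ?thesis by (simp add: has_field_derivative_def)
qed

text \<open>The mean value theorem, applied to the increment of \<open>g\<close> along \<open>t v\<close> as a function of the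
  step in direction \<open>u\<close>, turns the second difference into \<open>t\<close> times a first difference of
  \<open>g' y u\<close>. Differentiability of \<open>g' y u\<close> at the single point \<open>z\<close> controls the latter up to
  \<open>o(t)\<close>. The quotient is symmetric in \<open>u\<close> and \<open>v\<close>, and the limit inherits this.\<close>

lemma second_difference_tendsto:
  fixes g :: "'a::real_normed_vector \<Rightarrow> real"
  assumes g: "\<And>y. (g has_derivative g' y) (at y)"
    and H: "((\<lambda>y. g' y u) has_derivative H) (at z)"
  shows "((\<lambda>t. (g (z + t *\<^sub>R u + t *\<^sub>R v) - g (z + t *\<^sub>R u) - g (z + t *\<^sub>R v) + g z) / t\<^sup>2)
    \<longlongrightarrow> H v) (at_right 0)"
proof (rule tendstoI)
  fix e :: real assume "e > 0"
  \<comment> \<open>The two error terms of size \<open>c t (norm u + norm v)\<close> and \<open>c t norm u\<close> have to add up to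
    less than \<open>t e\<close>; adding 1 makes \<open>K\<close> positive even for \<open>u = v = 0\<close>.\<close>
  define K where "K = 2 * norm u + norm v + 1"
  have K: "K > 0" by (simp add: K_def add_nonneg_pos)
  define c where "c = e / (2 * K)"
  have c: "c > 0" using \<open>e > 0\<close> K by (simp add: c_def)
  interpret H: bounded_linear H using H by (rule has_derivative_bounded_linear)
  obtain d where d: "d > 0"
    and small: "\<And>y. norm (y - z) < d \<Longrightarrow> \<bar>g' y u - g' z u - H (y - z)\<bar> \<le> c * norm (y - z)"
    using H c unfolding has_derivative_at_alt by (metis real_norm_def)
  define S where "S = (\<lambda>t. g (z + t *\<^sub>R u + t *\<^sub>R v) - g (z + t *\<^sub>R u) - g (z + t *\<^sub>R v) + g z)"
  have bound: "\<bar>S t / t\<^sup>2 - H v\<bar> < e" if t: "0 < t" "t < d / K" for t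
  proof -
    define \<phi> where "\<phi> = (\<lambda>s. g (z + s *\<^sub>R u + t *\<^sub>R v) - g (z + s *\<^sub>R u))"
    define \<phi>' where "\<phi>' = (\<lambda>s. g' (z + s *\<^sub>R u + t *\<^sub>R v) u - g' (z + s *\<^sub>R u) u)"
    have "(\<phi> has_real_derivative \<phi>' s) (at s)" for s
      using DERIV_diff[OF has_derivative_along_line[OF g, where w="z + t *\<^sub>R v" and s=s and u=u]
          has_derivative_along_line[OF g, where w=z and s=s and u=u]]
      by (simp add: \<phi>_def \<phi>'_def ac_simps)
    then obtain s where s: "0 < s" "s < t" "\<phi> t - \<phi> 0 = (t - 0) * \<phi>' s"
      using MVT2[of 0 t \<phi> \<phi>'] t by blast
    have St: "S t = t * \<phi>' s" using s by (simp add: S_def \<phi>_def)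
    have n1: "norm (s *\<^sub>R u + t *\<^sub>R v) \<le> t * (norm u + norm v)"
    proof -
      have "norm (s *\<^sub>R u + t *\<^sub>R v) \<le> s * norm u + t * norm v"
        using norm_triangle_ineq[of "s *\<^sub>R u" "t *\<^sub>R v"] s t by simp
      also have "\<dots> \<le> t * norm u + t * norm v" using s by (simp add: mult_right_mono)
      finally show ?thesis by (simp add: algebra_simps)
    qed
    have n2: "norm (s *\<^sub>R u) \<le> t * norm u" using s by (simp add: mult_right_mono)
    have tK: "t * K < d" using t K by (simp add: field_simps)
    have "t * (norm u + norm v) \<le> t * K" "t * norm u \<le> t * K"
      using t by (auto simp: K_def intro!: mult_left_mono)
    then have lt: "norm (s *\<^sub>R u + t *\<^sub>R v) < d" "norm (s *\<^sub>R u) < d" using n1 n2 tK by auto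
    have "\<bar>g' (z + s *\<^sub>R u + t *\<^sub>R v) u - g' z u - H (s *\<^sub>R u + t *\<^sub>R v)\<bar> \<le> c * (t * (norm u + norm v))"
      using small[of "z + s *\<^sub>R u + t *\<^sub>R v"] lt(1) n1 c
      by (force simp: add.assoc intro: order_trans mult_left_mono)
    moreover have "\<bar>g' (z + s *\<^sub>R u) u - g' z u - H (s *\<^sub>R u)\<bar> \<le> c * (t * norm u)"
      using small[of "z + s *\<^sub>R u"] lt(2) n2 c
      by (force intro: order_trans mult_left_mono)
    ultimately have "\<bar>\<phi>' s - t * H v\<bar> \<le> c * (t * (norm u + norm v)) + c * (t * norm u)"
      unfolding \<phi>'_def H.add H.scaleR by (simp only: real_scaleR_def abs_le_iff) (simp add: algebra_simps; linarith)
    also have "\<dots> < c * (t * K)"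
      using c t by (simp add: K_def algebra_simps)
    also have "\<dots> < t * e" using c_def K t \<open>e > 0\<close> by (simp add: field_simps)
    finally have *: "\<bar>\<phi>' s - t * H v\<bar> < t * e" .
    have eq: "S t / t\<^sup>2 - H v = (\<phi>' s - t * H v) / t"
      using t by (simp add: St power2_eq_square field_simps)
    show ?thesis unfolding eq using * t by (simp add: abs_divide pos_divide_less_eq mult.commute)
  qed
  have "eventually (\<lambda>t. t < d / K) (at_right 0)"
    using d K by (intro eventually_at_right_real[THEN eventually_mono, of 0 "d/K"]) auto
  then show "\<forall>\<^sub>F t in at_right 0. dist ((g (z + t *\<^sub>R u + t *\<^sub>R v) - g (z + t *\<^sub>R u) - g (z + t *\<^sub>R v) + g z) / t\<^sup>2) (H v) < e"
    using eventually_at_right_less[of 0]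
    by eventually_elim (use bound in \<open>auto simp: S_def dist_real_def\<close>)
qed

lemma second_derivative_symmetric:
  fixes g :: "'a::real_normed_vector \<Rightarrow> real"
  assumes g: "\<And>y. (g has_derivative g' y) (at y)"
    and Hu: "((\<lambda>y. g' y u) has_derivative Hu) (at z)"
    and Hv: "((\<lambda>y. g' y v) has_derivative Hv) (at z)"
  shows "Hu v = Hv u"
proof (rule tendsto_unique)
  show "((\<lambda>t. (g (z + t *\<^sub>R u + t *\<^sub>R v) - g (z + t *\<^sub>R u) - g (z + t *\<^sub>R v) + g z) / t\<^sup>2)
    \<longlongrightarrow> Hu v) (at_right 0)"
    by (rule second_difference_tendsto[OF g Hu])
  show "((\<lambda>t. (g (z + t *\<^sub>R u + t *\<^sub>R v) - g (z + t *\<^sub>R u) - g (z + t *\<^sub>R v) + g z) / t\<^sup>2)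
    \<longlongrightarrow> Hv u) (at_right 0)"
    using second_difference_tendsto[OF g Hv, of u]
    by (simp add: algebra_simps)
qed simp

section \<open>Partial derivatives and total derivatives\<close>

lemma partials3_of_derivative:
  fixes F :: "real \<times> real \<times> real \<Rightarrow> real"
  assumes "(F has_derivative D) (at z)"
  shows F_dx_eq: "F_dx F z = D (1, 0, 0)"
    and F_dy_eq: "F_dy F z = D (0, 1, 0)"
    and F_da_eq: "F_da F z = D (0, 0, 1)"
    and total_derivative3:
      "D = (\<lambda>(h, k, l). F_dx F z * h + F_dy F z * k + F_da F z * l)"
proof -
  obtain x y a where z: "z = (x, y, a)" by (cases z)
  interpret D: bounded_linear D using assms by (rule has_derivative_bounded_linear)
  have D: "D (h, k, l) = h * D (1, 0, 0) + k * D (0, 1, 0) + l * D (0, 0, 1)" for h k l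
    using D.add[of "(h, 0, 0)" "(0, k, l)"] D.add[of "(0, k, 0)" "(0, 0, l)"]
      D.scaleR[of h "(1, 0, 0)"] D.scaleR[of k "(0, 1, 0)"] D.scaleR[of l "(0, 0, 1)"]
    by simp
  note along = has_derivative_along_line[of F D]
  show x: "F_dx F z = D (1, 0, 0)"
    using along[of "(0, y, a)" x "(1, 0, 0)"] assms by (simp add: F_dx_def z DERIV_imp_deriv)
  show y: "F_dy F z = D (0, 1, 0)"
    using along[of "(x, 0, a)" y "(0, 1, 0)"] assms by (simp add: F_dy_def z DERIV_imp_deriv)
  show a: "F_da F z = D (0, 0, 1)"
    using along[of "(x, y, 0)" a "(0, 0, 1)"] assms by (simp add: F_da_def z DERIV_imp_deriv)
  show "D = (\<lambda>(h, k, l). F_dx F z * h + F_dy F z * k + F_da F z * l)"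
    unfolding x y a by (rule ext, clarify, subst D, simp)
qed

lemma partials2_of_derivative:
  fixes g :: "real \<times> real \<Rightarrow> real"
  assumes "(g has_derivative D) (at z)"
  shows map_dx_eq: "map_dx g z = D (1, 0)"
    and map_da_eq: "map_da g z = D (0, 1)"
    and total_derivative2: "D = (\<lambda>(h, k). map_dx g z * h + map_da g z * k)"
proof -
  obtain x a where z: "z = (x, a)" by (cases z)
  interpret D: bounded_linear D using assms by (rule has_derivative_bounded_linear)
  have D: "D (h, k) = h * D (1, 0) + k * D (0, 1)" for h k
    using D.add[of "(h, 0)" "(0, k)"] D.scaleR[of h "(1, 0)"] D.scaleR[of k "(0, 1)"]
    by simp
  note along = has_derivative_along_line[of g D]
  show x: "map_dx g z = D (1, 0)"
    using along[of "(0, a)" x "(1, 0)"] assms by (simp add: map_dx_def z DERIV_imp_deriv)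
  show a: "map_da g z = D (0, 1)"
    using along[of "(x, 0)" a "(0, 1)"] assms by (simp add: map_da_def z DERIV_imp_deriv)
  show "D = (\<lambda>(h, k). map_dx g z * h + map_da g z * k)"
    unfolding x a by (rule ext, clarify, subst D, simp)
qed

lemma blinfun_derivative_at_vector:
  assumes "(g' has_derivative blinfun_apply G) (at z)"
  shows "((\<lambda>y. blinfun_apply (g' y) u) has_derivative (\<lambda>h. blinfun_apply (blinfun_apply G h) u)) (at z)"
  by (rule bounded_linear.has_derivative[OF _ assms, where f="\<lambda>L. blinfun_apply L u"])
    (rule bounded_linear_intros)+

text \<open>The partial derivatives of \<open>F\<close> are values of its Frechet derivative at the unit vectors,
  hence themselves differentiable in all variables jointly.\<close>

lemma C2_on_UNIV_partials:
  assumes "C2_on UNIV F"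
  shows F_total: "(F has_derivative (\<lambda>(h, k, l). F_dx F z * h + F_dy F z * k + F_da F z * l)) (at z)"
    and F_dx_total: "(F_dx F has_derivative
      (\<lambda>(h, k, l). F_dx (F_dx F) z * h + F_dy (F_dx F) z * k + F_da (F_dx F) z * l)) (at z)"
    and F_dy_total: "(F_dy F has_derivative
      (\<lambda>(h, k, l). F_dx (F_dy F) z * h + F_dy (F_dy F) z * k + F_da (F_dy F) z * l)) (at z)"
    and F_mixed: "F_dx (F_dy F) z = F_dy (F_dx F) z"
proof -
  obtain F' F'' where F': "\<And>z. (F has_derivative blinfun_apply (F' z)) (at z)"
    and F'': "\<And>z. (F' has_derivative blinfun_apply (F'' z)) (at z)"
    using assms unfolding C2_on_def by auto
  have dx: "F_dx F = (\<lambda>z. blinfun_apply (F' z) (1, 0, 0))"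
    and dy: "F_dy F = (\<lambda>z. blinfun_apply (F' z) (0, 1, 0))"
    using F_dx_eq[OF F'] F_dy_eq[OF F'] by auto
  note dx' = blinfun_derivative_at_vector[OF F''[of z], of "(1, 0, 0)", folded dx]
  note dy' = blinfun_derivative_at_vector[OF F''[of z], of "(0, 1, 0)", folded dy]
  show "(F has_derivative (\<lambda>(h, k, l). F_dx F z * h + F_dy F z * k + F_da F z * l)) (at z)"
    using F'[of z] total_derivative3[OF F'[of z]] by simp
  show "(F_dx F has_derivative
      (\<lambda>(h, k, l). F_dx (F_dx F) z * h + F_dy (F_dx F) z * k + F_da (F_dx F) z * l)) (at z)"
    using dx' total_derivative3[OF dx'] by simp
  show "(F_dy F has_derivative
      (\<lambda>(h, k, l). F_dx (F_dy F) z * h + F_dy (F_dy F) z * k + F_da (F_dy F) z * l)) (at z)"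
    using dy' total_derivative3[OF dy'] by simp
  show "F_dx (F_dy F) z = F_dy (F_dx F) z"
    unfolding F_dx_eq[OF dy'] F_dy_eq[OF dx']
    by (rule second_derivative_symmetric[OF F' dy'[unfolded dy] dx'[unfolded dx]])
qed

text \<open>Outside \<open>U\<close> the function \<open>map_dx f\<close> is unrelated to the Frechet derivative of \<open>f\<close>;
  openness of \<open>U\<close> makes them agree near \<open>z\<close>.\<close>

lemma C2_on_open_partials:
  assumes "C2_on U f" "open U" "z \<in> U"
  shows f_total: "(f has_derivative (\<lambda>(h, k). map_dx f z * h + map_da f z * k)) (at z)"
    and f_dx_total: "(map_dx f has_derivative
      (\<lambda>(h, k). map_dx (map_dx f) z * h + map_da (map_dx f) z * k)) (at z)"
proof -
  obtain f' f'' where f': "\<And>z. z \<in> U \<Longrightarrow> (f has_derivative blinfun_apply (f' z)) (at z)"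
    and f'': "\<And>z. z \<in> U \<Longrightarrow> (f' has_derivative blinfun_apply (f'' z)) (at z)"
    using assms unfolding C2_on_def by auto
  show "(f has_derivative (\<lambda>(h, k). map_dx f z * h + map_da f z * k)) (at z)"
    using f'[of z] total_derivative2[OF f'[of z]] assms by simp
  have dx': "(map_dx f has_derivative (\<lambda>h. blinfun_apply (blinfun_apply (f'' z) h) (1, 0))) (at z)"
    using blinfun_derivative_at_vector[OF f'', of z "(1, 0)"] assms(2,3)
    by (rule has_derivative_transform_within_open) (use map_dx_eq[OF f'] assms in auto)
  show "(map_dx f has_derivative
      (\<lambda>(h, k). map_dx (map_dx f) z * h + map_da (map_dx f) z * k)) (at z)"
    using dx' total_derivative2[OF dx'] by simp
qed

lemma has_derivative_slice_snd:
  fixes g :: "real \<times> real \<Rightarrow> real"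
  assumes "(g has_derivative (\<lambda>(h, k). m * h + n * k)) (at (x, a))"
  shows "((\<lambda>a. g (x, a)) has_real_derivative n) (at a)"
  using has_derivative_along_line[of g _ "(x, 0)" a "(0, 1)"] assms by fastforce

lemma has_derivative_slice_fst:
  fixes g :: "real \<times> real \<Rightarrow> real"
  assumes "(g has_derivative (\<lambda>(h, k). m * h + n * k)) (at (x, a))"
  shows "((\<lambda>t. g (t, a)) has_real_derivative m) (at x)"
  using has_derivative_along_line[of g _ "(0, a)" x "(1, 0)"] assms by fastforce

section \<open>Implicit differentiation\<close>

lemma implicit_partials:
  fixes F :: "real \<times> real \<times> real \<Rightarrow> real" and f :: "real \<times> real \<Rightarrow> real"
  assumes F: "C2_on UNIV F" and U: "open U" and f: "C2_on U f"
    and zero: "\<forall>(t, a)\<in>U. F (t, f (t, a), a) = 0"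
    and z: "(t, a) \<in> U" and w: "w = (t, f (t, a), a)"
  shows implicit_dx: "F_dx F w + F_dy F w * map_dx f (t, a) = 0"
    and implicit_da: "F_da F w + F_dy F w * map_da f (t, a) = 0"
proof -
  note f' = f_total[OF f U z]
  have g: "((\<lambda>z. (fst z, f z, snd z)) has_derivative
      (\<lambda>h. (fst h, (case h of (h, k) \<Rightarrow> map_dx f (t, a) * h + map_da f (t, a) * k), snd h))) (at (t, a))"
    by (intro derivative_intros f')
  have "((\<lambda>z. F (fst z, f z, snd z)) has_derivative
      (\<lambda>(h, k). F_dx F w * h + F_dy F w * (map_dx f (t, a) * h + map_da f (t, a) * k) + F_da F w * k)) (at (t, a))"
    using has_derivative_compose[OF g, of F, OF F_total[OF F]] by (simp add: w case_prod_unfold)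
  moreover have "((\<lambda>z. F (fst z, f z, snd z)) has_derivative (\<lambda>h. 0)) (at (t, a))"
    by (rule has_derivative_transform_within_open[OF has_derivative_const[of 0] U z])
      (use zero in auto)
  ultimately have "(\<lambda>(h, k). F_dx F w * h + F_dy F w * (map_dx f (t, a) * h + map_da f (t, a) * k) + F_da F w * k) = (\<lambda>h. 0)"
    by (rule has_derivative_unique)
  from fun_cong[OF this, of "(1, 0)"] fun_cong[OF this, of "(0, 1)"]
  show "F_dx F w + F_dy F w * map_dx f (t, a) = 0" "F_da F w + F_dy F w * map_da f (t, a) = 0"
    by (simp_all add: algebra_simps)
qed

text \<open>The first relation \<open>F\<^sub>x + F\<^sub>y f\<^sub>x = 0\<close> holds on all of \<open>U\<close>, so it can be differentiated
  again, in both variables. In the \<open>x\<close> direction the terms \<open>F\<^sub>x\<^sub>y f\<^sub>x\<close> and \<open>F\<^sub>y\<^sub>x f\<^sub>x\<close> combine.\<close>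

lemma implicit_second_partials:
  fixes F :: "real \<times> real \<times> real \<Rightarrow> real" and f :: "real \<times> real \<Rightarrow> real"
  assumes F: "C2_on UNIV F" and U: "open U" and f: "C2_on U f"
    and zero: "\<forall>(t, a)\<in>U. F (t, f (t, a), a) = 0"
    and z: "(t, a) \<in> U" and w: "w = (t, f (t, a), a)"
  shows implicit_dxx: "F_dx (F_dx F) w + 2 * F_dy (F_dx F) w * map_dx f (t, a)
        + F_dy (F_dy F) w * (map_dx f (t, a))\<^sup>2 + F_dy F w * map_dx (map_dx f) (t, a) = 0"
    and implicit_dxa: "F_da (F_dx F) w + F_dy (F_dx F) w * map_da f (t, a)
        + (F_da (F_dy F) w + F_dy (F_dy F) w * map_da f (t, a)) * map_dx f (t, a)
        + F_dy F w * map_da (map_dx f) (t, a) = 0"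
proof -
  note f' = f_total[OF f U z]
  define D where "D = (\<lambda>(h, k). map_dx f (t, a) * h + map_da f (t, a) * k)"
  have g: "((\<lambda>z. (fst z, f z, snd z)) has_derivative (\<lambda>h. (fst h, D h, snd h))) (at (t, a))"
    unfolding D_def by (intro derivative_intros f')
  have P: "((\<lambda>z. F_dx F (fst z, f z, snd z)) has_derivative
      (\<lambda>h. F_dx (F_dx F) w * fst h + F_dy (F_dx F) w * D h + F_da (F_dx F) w * snd h)) (at (t, a))"
    using has_derivative_compose[OF g, of "F_dx F", OF F_dx_total[OF F]] by (simp add: w)
  have Q: "((\<lambda>z. F_dy F (fst z, f z, snd z)) has_derivative
      (\<lambda>h. F_dx (F_dy F) w * fst h + F_dy (F_dy F) w * D h + F_da (F_dy F) w * snd h)) (at (t, a))"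
    using has_derivative_compose[OF g, of "F_dy F", OF F_dy_total[OF F]] by (simp add: w)
  let ?G = "\<lambda>z. F_dx F (fst z, f z, snd z) + F_dy F (fst z, f z, snd z) * map_dx f z"
  let ?E = "\<lambda>h. (F_dx (F_dx F) w * fst h + F_dy (F_dx F) w * D h + F_da (F_dx F) w * snd h)
    + (F_dy F w * (case h of (h, k) \<Rightarrow> map_dx (map_dx f) (t, a) * h + map_da (map_dx f) (t, a) * k)
      + (F_dx (F_dy F) w * fst h + F_dy (F_dy F) w * D h + F_da (F_dy F) w * snd h) * map_dx f (t, a))"
  have "(?G has_derivative ?E) (at (t, a))"
    using has_derivative_add[OF P has_derivative_mult[OF Q f_dx_total[OF f U z]]] by (simp add: w)
  moreover have "(?G has_derivative (\<lambda>h. 0)) (at (t, a))"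
    by (rule has_derivative_transform_within_open[OF has_derivative_const[of 0] U z])
      (use implicit_dx[OF F U f zero _ refl] in auto)
  ultimately have "?E = (\<lambda>h. 0)"
    by (rule has_derivative_unique)
  from fun_cong[OF this, of "(1, 0)"] fun_cong[OF this, of "(0, 1)"] F_mixed[OF F, of w]
  show "F_dx (F_dx F) w + 2 * F_dy (F_dx F) w * map_dx f (t, a)
        + F_dy (F_dy F) w * (map_dx f (t, a))\<^sup>2 + F_dy F w * map_dx (map_dx f) (t, a) = 0"
    "F_da (F_dx F) w + F_dy (F_dx F) w * map_da f (t, a)
        + (F_da (F_dy F) w + F_dy (F_dy F) w * map_da f (t, a)) * map_dx f (t, a)
        + F_dy F w * map_da (map_dx f) (t, a) = 0"
    by (simp_all add: D_def algebra_simps power2_eq_square)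
qed

text \<open>The algebra that joins the two sides: with \<open>f\<^sub>x = -F\<^sub>x / F\<^sub>y\<close> and \<open>f\<^sub>\<alpha> = -F\<^sub>\<alpha> / F\<^sub>y\<close>, the
  logarithmic derivative of one slope becomes a summand of the final formula; \<open>d\<close> stands for
  \<open>\<partial>\<^sub>\<alpha>f\<^sup>j\<close>.\<close>

lemma implicit_log_derivative:
  fixes fx fa fxx fxa Fx Fy Fa Fxx Fxy Fyy Fxa Fya d :: real
  assumes nz: "fx \<noteq> 0" "Fy \<noteq> 0"
    and x: "Fx + Fy * fx = 0" and a: "Fa + Fy * fa = 0"
    and xx: "Fxx + 2 * Fxy * fx + Fyy * fx\<^sup>2 + Fy * fxx = 0"
    and xa: "Fxa + Fxy * fa + (Fya + Fyy * fa) * fx + Fy * fxa = 0"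
  shows "(fxx * d + fxa) / fx =
    (Fxx - 2 * Fxy * (Fx / Fy) + Fyy * (Fx / Fy)\<^sup>2) / Fx * d
    + (Fyy / Fy - Fxy / Fx) * (Fa / Fy) + Fxa / Fx - Fya / Fy"
proof -
  have Fx: "Fx = - Fy * fx" and Fa: "Fa = - Fy * fa" using x a by auto
  have Fxx: "Fxx = - (2 * Fxy * fx + Fyy * fx\<^sup>2 + Fy * fxx)"
    and Fxa: "Fxa = - (Fxy * fa + (Fya + Fyy * fa) * fx + Fy * fxa)"
    using xx xa by auto
  show ?thesis
    using nz unfolding Fx Fa Fxx Fxa by (simp add: field_simps power2_eq_square)
qed

section \<open>Derivatives of the iterates\<close>

lemma iter_0 [simp]: "iter f 0 z = fst z"
  by (simp add: iter_def split_beta)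

lemma iter_Suc [simp]: "iter f (Suc j) z = f (iter f j z, snd z)"
  by (simp add: iter_def split_beta)

text \<open>The iterates are differentiated in \<open>(x, a)\<close> jointly: the map
  \<open>f\<^sup>i\<^sup>+\<^sup>1(z) = f(f\<^sup>i(z), a)\<close> depends on \<open>a\<close> both through \<open>f\<^sup>i\<close> and directly, and the direct
  dependence is the inhomogeneous term \<open>f\<^sub>\<alpha>\<close> of the recurrence for \<open>\<partial>\<^sub>\<alpha>f\<^sup>i\<close>.\<close>

lemma iter_partials:
  assumes f: "C2_on U f" and U: "open U"
    and orbit: "\<And>i. i < j \<Longrightarrow> (iter f i z, snd z) \<in> U"
  shows iter_total: "(iter f j has_derivative
      (\<lambda>(h, k). map_dx (iter f j) z * h + map_da (iter f j) z * k)) (at z)"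
    and iter_dx: "map_dx (iter f j) z = (\<Prod>i<j. map_dx f (iter f i z, snd z))"
    and iter_da: "\<And>i. i < j \<Longrightarrow> map_da (iter f (Suc i)) z
      = map_dx f (iter f i z, snd z) * map_da (iter f i) z + map_da f (iter f i z, snd z)"
proof -
  have step: "(iter f (Suc i) has_derivative (\<lambda>(h, k). map_dx f (iter f i z, snd z) * m * h
        + (map_dx f (iter f i z, snd z) * n + map_da f (iter f i z, snd z)) * k)) (at z)"
    if "(iter f i has_derivative (\<lambda>(h, k). m * h + n * k)) (at z)" "i < j" for i m n
  proof -
    have "((\<lambda>z. (iter f i z, snd z)) has_derivative (\<lambda>h. (case h of (h, k) \<Rightarrow> m * h + n * k, snd h))) (at z)"
      by (intro derivative_intros that)
    from has_derivative_compose[OF this, of f, OF f_total[OF f U orbit[OF \<open>i < j\<close>]]]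
    show ?thesis
      unfolding iter_Suc[abs_def] by (simp add: case_prod_unfold algebra_simps)
  qed
  have base: "(iter f 0 has_derivative (\<lambda>(h, k). 1 * h + 0 * k)) (at z)"
  proof -
    have "iter f 0 = fst" "(\<lambda>(h, k). 1 * h + 0 * k) = (fst :: real \<times> real \<Rightarrow> real)" by auto
    then show ?thesis using bounded_linear_imp_has_derivative[OF bounded_linear_fst] by metis
  qed
  \<comment> \<open>Only the \<open>x\<close> coefficient needs a closed form here; the other one is identified with
    \<open>map_da\<close> afterwards, by uniqueness of derivatives.\<close>
  have ex: "\<exists>n. (iter f i has_derivative
      (\<lambda>(h, k). (\<Prod>l<i. map_dx f (iter f l z, snd z)) * h + n * k)) (at z)" if "i \<le> j" for i
    using that
  proof (induction i)
    case 0
    then show ?case using base by (intro exI[of _ 0]) (simp del: iter_0)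
  next
    case (Suc i)
    then obtain n where "(iter f i has_derivative
      (\<lambda>(h, k). (\<Prod>l<i. map_dx f (iter f l z, snd z)) * h + n * k)) (at z)" by auto
    from step[OF this] Suc.prems show ?case by (auto simp: mult.commute simp del: iter_Suc)
  qed
  have total: "(iter f i has_derivative
      (\<lambda>(h, k). map_dx (iter f i) z * h + map_da (iter f i) z * k)) (at z)" if "i \<le> j" for i
    using ex[OF that] total_derivative2 by metis
  show "(iter f j has_derivative
      (\<lambda>(h, k). map_dx (iter f j) z * h + map_da (iter f j) z * k)) (at z)"
    by (rule total) simp
  show "map_dx (iter f j) z = (\<Prod>i<j. map_dx f (iter f i z, snd z))"
    using ex[of j] by (auto dest: map_dx_eq)
  show "map_da (iter f (Suc i)) z
      = map_dx f (iter f i z, snd z) * map_da (iter f i) z + map_da f (iter f i z, snd z)"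
    if "i < j" for i
    using map_da_eq[OF step[OF total]] that by simp
qed

text \<open>Differentiating \<open>\<partial>\<^sub>x f\<^sup>p(x\<^sub>0, a)\<close> in \<open>a\<close> requires the product formula for it at all nearby
  parameters, hence nearby orbits inside \<open>U\<close>.\<close>

lemma eventually_orbit_in_open:
  assumes f: "C2_on U f" and U: "open U"
    and orbit: "\<And>i. i < j \<Longrightarrow> (iter f i z, snd z) \<in> U"
  shows "\<forall>\<^sub>F y in nhds z. \<forall>i<j. (iter f i y, snd y) \<in> U"
proof -
  have "\<forall>\<^sub>F y in nhds z. (iter f i y, snd y) \<in> U" if "i < j" for i
  proof -
    have "isCont (iter f i) z"
      by (rule has_derivative_continuous[OF iter_total[OF f U]]) (use orbit that in auto)
    then have "isCont (\<lambda>y. (iter f i y, snd y)) z" by (intro continuous_intros)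
    then have "filterlim (\<lambda>y. (iter f i y, snd y)) (nhds (iter f i z, snd z)) (nhds z)"
      unfolding isCont_def by (rule tendsto_at_iff_tendsto_nhds[THEN iffD1])
    from topological_tendstoD[OF this U orbit[OF that]] show ?thesis .
  qed
  then have "\<forall>\<^sub>F y in nhds z. \<forall>i\<in>{..<j}. (iter f i y, snd y) \<in> U"
    by (intro eventually_ball_finite) auto
  then show ?thesis by (simp add: Ball_def)
qed

text \<open>For \<open>a\<close> near \<open>\<alpha>\<close> the derivative \<open>\<partial>\<^sub>x f\<^sup>p(x\<^sub>0, a)\<close> is a product of slopes along the orbit; a
  nonzero product allows the logarithmic form of the product rule. The orbit point moves with
  \<open>a\<close>, which produces the term with \<open>f\<^sub>x\<^sub>x\<close>.\<close>

lemma iter_mixed_derivative: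
  fixes x0 \<alpha> :: real
  assumes f: "C2_on U f" and U: "open U"
    and orbit: "\<And>i. i < p \<Longrightarrow> (iter f i (x0, \<alpha>), \<alpha>) \<in> U"
    and nz: "map_dx (iter f p) (x0, \<alpha>) \<noteq> 0"
  defines "w \<equiv> \<lambda>j. (iter f j (x0, \<alpha>), \<alpha>)"
  shows "((\<lambda>a. map_dx (iter f p) (x0, a)) has_real_derivative
    map_dx (iter f p) (x0, \<alpha>) * (\<Sum>j<p.
      (map_dx (map_dx f) (w j) * map_da (iter f j) (x0, \<alpha>) + map_da (map_dx f) (w j))
        / map_dx f (w j))) (at \<alpha>)"
proof -
  let ?P = "\<lambda>a. \<Prod>j<p. map_dx f (iter f j (x0, a), a)"
  have "filterlim (\<lambda>a. (x0, a)) (nhds (x0, \<alpha>)) (nhds \<alpha>)"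
    by (intro tendsto_intros filterlim_ident)
  from eventually_compose_filterlim[OF eventually_orbit_in_open[OF f U, of p "(x0, \<alpha>)"] this]
  have ev: "\<forall>\<^sub>F a in nhds \<alpha>. map_dx (iter f p) (x0, a) = ?P a"
    using orbit by (auto elim!: eventually_mono simp: iter_dx[OF f U])
  have eq: "map_dx (iter f p) (x0, \<alpha>) = ?P \<alpha>"
    using eventually_nhds_x_imp_x[OF ev] .
  have fac: "((\<lambda>a. map_dx f (iter f j (x0, a), a)) has_real_derivative
      map_dx (map_dx f) (w j) * map_da (iter f j) (x0, \<alpha>) + map_da (map_dx f) (w j)) (at \<alpha>)"
    if "j < p" for j
  proof -
    have "((\<lambda>a. iter f j (x0, a)) has_real_derivative map_da (iter f j) (x0, \<alpha>)) (at \<alpha>)"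
      by (rule has_derivative_slice_snd[OF iter_total[OF f U]]) (use orbit that in auto)
    then have "((\<lambda>a. (iter f j (x0, a), a)) has_derivative (\<lambda>h. (map_da (iter f j) (x0, \<alpha>) * h, h))) (at \<alpha>)"
      unfolding has_field_derivative_def by (intro derivative_intros)
    from has_derivative_compose[OF this, of "map_dx f", OF f_dx_total[OF f U orbit[OF that]]]
    show ?thesis
      unfolding has_field_derivative_def
      by (rule has_derivative_eq_rhs) (auto simp: w_def algebra_simps)
  qed
  have "(?P has_real_derivative ?P \<alpha> * (\<Sum>j<p.
      (map_dx (map_dx f) (w j) * map_da (iter f j) (x0, \<alpha>) + map_da (map_dx f) (w j))
        / map_dx f (iter f j (x0, \<alpha>), \<alpha>))) (at \<alpha>)"
    by (rule has_field_derivative_prod') (use nz fac in \<open>auto simp: eq\<close>)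
  then show ?thesis
    unfolding DERIV_cong_ev[OF refl ev refl] eq by (simp add: w_def)
qed

text \<open>Variation of constants for the recurrence that the derivatives \<open>\<partial>\<^sub>\<alpha>f\<^sup>j\<close> satisfy.\<close>

lemma alternating_recurrence_closed_form:
  fixes d b \<nu> :: "nat \<Rightarrow> real"
  assumes "d 0 = 0" and "\<And>k. k < j \<Longrightarrow> d (Suc k) = - \<nu> k * d k - b k"
  shows "d j = (-1) ^ j * (\<Sum>k<j. (-1) ^ k * b k * (\<Prod>i = k+1..<j. \<nu> i))"
  using assms(2)
proof (induction j)
  case 0
  then show ?case using assms(1) by simp
next
  case (Suc j)
  have "(\<Sum>k<j. (-1) ^ k * b k * (\<Prod>i = k+1..<Suc j. \<nu> i))
      = \<nu> j * (\<Sum>k<j. (-1) ^ k * b k * (\<Prod>i = k+1..<j. \<nu> i))"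
    unfolding sum_distrib_left by (intro sum.cong refl) (simp add: mult_ac)
  moreover have "d j = (-1) ^ j * (\<Sum>k<j. (-1) ^ k * b k * (\<Prod>i = k+1..<j. \<nu> i))"
    using Suc by simp
  moreover have "(-1) ^ j * ((-1) ^ j * c) = c" for c :: real
    by (simp flip: mult.assoc power_mult_distrib)
  ultimately show ?case
    using Suc.prems[of j] by (simp add: algebra_simps)
qed

section \<open>The mixed derivative at a periodic point\<close>

theorem proposition3p6:
  fixes F :: "real \<times> real \<times> real \<Rightarrow> real"
    and f :: "real \<times> real \<Rightarrow> real"
    and U :: "(real \<times> real) set"
    and x0 \<alpha> \<epsilon> :: real
    and x :: "nat \<Rightarrow> real"
    and p :: nat
  assumes "C2_on UNIV F"
    and "open U"
    and "C2_on U f"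
    and "\<forall>(t, a)\<in>U. F (t, f (t, a), a) = 0"
    and "p \<ge> 1"
    and "\<forall>j. x j = iter f j (x0, \<alpha>)"
    and "\<forall>j<p. (x j, \<alpha>) \<in> U"
    and "x p = x0"
    and "\<forall>j<p. F_dy F (x j, x (Suc j), \<alpha>) \<noteq> 0"
    and "\<epsilon> \<in> {1, -1}"
    and "map_dx (iter f p) (x0, \<alpha>) = \<epsilon>"
  shows
    "let Fx  = (\<lambda>j. F_dx F (x j, x (Suc j), \<alpha>));
         Fy  = (\<lambda>j. F_dy F (x j, x (Suc j), \<alpha>));
         Fa  = (\<lambda>j. F_da F (x j, x (Suc j), \<alpha>));
         Fxx = (\<lambda>j. F_dx (F_dx F) (x j, x (Suc j), \<alpha>));
         Fxy = (\<lambda>j. F_dy (F_dx F) (x j, x (Suc j), \<alpha>));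
         Fyy = (\<lambda>j. F_dy (F_dy F) (x j, x (Suc j), \<alpha>));
         Fxa = (\<lambda>j. F_da (F_dx F) (x j, x (Suc j), \<alpha>));
         Fya = (\<lambda>j. F_da (F_dy F) (x j, x (Suc j), \<alpha>));
         \<nu>   = (\<lambda>j. Fx j / Fy j)
     in
       (\<forall>j<p. ((\<lambda>a. iter f j (x0, a)) has_real_derivative
           (-1) ^ j * (\<Sum>k<j. (-1) ^ k * Fa k / Fy k * (\<Prod>i = k+1..<j. \<nu> i))) (at \<alpha>)) \<and>
       (\<forall>\<^sub>F a in nhds \<alpha>. (\<lambda>t. iter f p (t, a)) differentiable (at x0)) \<and>
       ((\<lambda>a. map_dx (iter f p) (x0, a)) has_real_derivative
           \<epsilon> * (\<Sum>j<p.
             (Fxx j - 2 * Fxy j * \<nu> j + Fyy j * (\<nu> j)\<^sup>2) / Fx j * map_da (iter f j) (x0, \<alpha>)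
             + (Fyy j / Fy j - Fxy j / Fx j) * (Fa j / Fy j)
             + Fxa j / Fx j - Fya j / Fy j)) (at \<alpha>)"
proof -
  note F = assms(1) and U = assms(2) and f = assms(3) and zero = assms(4)
  have x: "x j = iter f j (x0, \<alpha>)" for j using assms(6) by simp
  have orbit: "(iter f j (x0, \<alpha>), \<alpha>) \<in> U" if "j < p" for j using assms(7) that x by simp
  have w: "(x j, x (Suc j), \<alpha>) = (x j, f (x j, \<alpha>), \<alpha>)" for j by (simp add: x)
  have inU: "(x j, \<alpha>) \<in> U" if "j < p" for j using assms(7) that by simp
  have Fy: "F_dy F (x j, x (Suc j), \<alpha>) \<noteq> 0" if "j < p" for j using assms(9) that by simp
  have \<epsilon>: "\<epsilon> \<noteq> 0" "map_dx (iter f p) (x0, \<alpha>) = \<epsilon>" using assms(10,11) by auto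
  \<comment> \<open>A vanishing slope would make the product \<open>\<epsilon>\<close> vanish.\<close>
  have fx: "map_dx f (x j, \<alpha>) \<noteq> 0" if "j < p" for j
    using \<epsilon> iter_dx[OF f U, of p "(x0, \<alpha>)"] orbit that by (auto simp: x)
  note dx = implicit_dx[OF F U f zero inU w] and da = implicit_da[OF F U f zero inU w]
    and dxx = implicit_dxx[OF F U f zero inU w] and dxa = implicit_dxa[OF F U f zero inU w]
  let ?Fx = "\<lambda>j. F_dx F (x j, x (Suc j), \<alpha>)" and ?Fy = "\<lambda>j. F_dy F (x j, x (Suc j), \<alpha>)"
    and ?Fa = "\<lambda>j. F_da F (x j, x (Suc j), \<alpha>)"
  have d: "((\<lambda>a. iter f j (x0, a)) has_real_derivative
      (-1) ^ j * (\<Sum>k<j. (-1) ^ k * ?Fa k / ?Fy k * (\<Prod>i = k+1..<j. ?Fx i / ?Fy i))) (at \<alpha>)"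
    if "j < p" for j
  proof -
    have "map_da (iter f 0) (x0, \<alpha>) = 0"
      by (simp add: map_da_def)
    moreover have "map_da (iter f (Suc k)) (x0, \<alpha>)
        = - (?Fx k / ?Fy k) * map_da (iter f k) (x0, \<alpha>) - ?Fa k / ?Fy k" if "k < j" for k
    proof -
      have "k < p" using that \<open>j < p\<close> by simp
      have "map_dx f (x k, \<alpha>) = - (?Fx k / ?Fy k)" "map_da f (x k, \<alpha>) = - (?Fa k / ?Fy k)"
        using dx[OF \<open>k < p\<close>] da[OF \<open>k < p\<close>] Fy[OF \<open>k < p\<close>] by (auto simp: field_simps)
      then show ?thesis
        using iter_da[OF f U, of p "(x0, \<alpha>)" k] orbit \<open>k < p\<close> by (simp add: x)
    qed
    ultimately have "map_da (iter f j) (x0, \<alpha>)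
        = (-1) ^ j * (\<Sum>k<j. (-1) ^ k * (?Fa k / ?Fy k) * (\<Prod>i = k+1..<j. ?Fx i / ?Fy i))"
      by (rule alternating_recurrence_closed_form[where d="\<lambda>k. map_da (iter f k) (x0, \<alpha>)"])
    moreover have "((\<lambda>a. iter f j (x0, a)) has_real_derivative map_da (iter f j) (x0, \<alpha>)) (at \<alpha>)"
      by (rule has_derivative_slice_snd[OF iter_total[OF f U]]) (use orbit that in auto)
    ultimately show ?thesis by simp
  qed
  have "filterlim (\<lambda>a. (x0, a)) (nhds (x0, \<alpha>)) (nhds \<alpha>)"
    by (intro tendsto_intros filterlim_ident)
  from eventually_compose_filterlim[OF eventually_orbit_in_open[OF f U, of p "(x0, \<alpha>)"] this]
  have diff: "\<forall>\<^sub>F a in nhds \<alpha>. (\<lambda>t. iter f p (t, a)) differentiable (at x0)"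
    using orbit by (auto elim!: eventually_mono simp: real_differentiable_def
      intro!: exI has_derivative_slice_fst[OF iter_total[OF f U]])
  have "((\<lambda>a. map_dx (iter f p) (x0, a)) has_real_derivative \<epsilon> * (\<Sum>j<p.
      (map_dx (map_dx f) (x j, \<alpha>) * map_da (iter f j) (x0, \<alpha>) + map_da (map_dx f) (x j, \<alpha>))
        / map_dx f (x j, \<alpha>))) (at \<alpha>)"
    using iter_mixed_derivative[OF f U orbit, of p] \<epsilon> by (simp add: x)
  then have mixed: "((\<lambda>a. map_dx (iter f p) (x0, a)) has_real_derivative \<epsilon> * (\<Sum>j<p.
      (F_dx (F_dx F) (x j, x (Suc j), \<alpha>) - 2 * F_dy (F_dx F) (x j, x (Suc j), \<alpha>) * (?Fx j / ?Fy j)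
        + F_dy (F_dy F) (x j, x (Suc j), \<alpha>) * (?Fx j / ?Fy j)\<^sup>2) / ?Fx j * map_da (iter f j) (x0, \<alpha>)
      + (F_dy (F_dy F) (x j, x (Suc j), \<alpha>) / ?Fy j - F_dy (F_dx F) (x j, x (Suc j), \<alpha>) / ?Fx j)
        * (?Fa j / ?Fy j)
      + F_da (F_dx F) (x j, x (Suc j), \<alpha>) / ?Fx j - F_da (F_dy F) (x j, x (Suc j), \<alpha>) / ?Fy j)) (at \<alpha>)"
    by (subst sum.cong[OF refl implicit_log_derivative[OF fx Fy dx da dxx dxa, symmetric]]) auto
  show ?thesis
    unfolding Let_def using d diff mixed by blast
qed

end
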